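(* Let $p,q$ be prime numbers with $p<q<p^2$, and let $M=p^4q^2$. Then there exist functions $f,g:\mathbb{Z}_M\to\mathbb{R}$ such that (i) $f(0)=g(0)=1$; (ii) $f\ge 0$ and $g\ge 0$; (iii) $\hat f\ge 0$ and $\hat g\ge 0$; (iv) $f\ast g=\mathbf{1}_{\mathbb{Z}_M}$; (v) both $f$ and $g$ are step functions; (vi) the mask polynomials $F$ and $G$ of $f$ and $g$ both satisfy condition (T1); (vii) neither $F$ nor $G$ satisfies condition (T2).
   Context: Identify $\mathbb{Z}_M$ with $\{0,1,\dots,M-1\}$. For $f:\mathbb{Z}_M\to\mathbb{C}$, its Fourier transform is $\hat f(\xi)=\sum_{z\in\mathbb{Z}_M} f(z)e^{-2\pi i z\xi/M}$, its mask polynomial is $F(X)=\sum_{z=0}^{M-1}f(z)X^z$, and convolution is $(f\ast g)(x)=\sum_{y\in\mathbb{Z}_M}f(y)g(x-y)$. For $m\mid M$ the step class is $R_m=\{z\in\mathbb{Z}_M:\gcd(z,M)=m\}$ (so $R_M=\{0\}$); $f$ is a step function if it is constant on each $R_m$. Let $\eta=e^{-2\pi i/M}$. For $m\mid M$ we say $\Phi_m(X)\mid F(X)$ if $F(\eta^\xi)=0$ for all $\xi\in R_{M/m}$, where $\Phi_m$ is the $m$-th cyclotomic polynomial. Let $S_F$ be the set of prime powers $p^\alpha\mid M$ ($\alpha\ge1$) with $\Phi_{p^\alpha}(X)\mid F(X)$. Condition (T1) for $F$: $F(1)=\prod_{s\in S_F}\Phi_s(1)$. Condition (T2) for $F$: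 whenever $s_1,\dots,s_k\in S_F$ are powers of distinct primes, $\Phi_{s_1\cdots s_k}(X)\mid F(X)$. *)

theory Defs
  imports
    "HOL-Analysis.Analysis"
    "HOL-Number_Theory.Totient"
    "HOL-Number_Theory.Prime_Powers"
    "HOL-Computational_Algebra.Polynomial"
    "HOL-Library.Nonpos_Ints"
begin

text \<open>
  The group $\mathbb{Z}_M$ is identified with the set \<open>{..<M}\<close> of residues, so a function on
  $\mathbb{Z}_M$ is a function on \<^typ>\<open>nat\<close> of which only the values on \<open>{..<M}\<close> matter.
\<close>

definition fourier :: "nat \<Rightarrow> (nat \<Rightarrow> complex) \<Rightarrow> nat \<Rightarrow> complex" where
  "fourier M f \<xi> =
     (\<Sum>z<M. f z * exp (- 2 * of_real pi * \<i> * of_nat z * of_nat \<xi> / of_nat M))"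

definition mask_poly :: "nat \<Rightarrow> (nat \<Rightarrow> complex) \<Rightarrow> complex poly" where
  "mask_poly M f = (\<Sum>z<M. monom (f z) z)"

text \<open>For \<open>y < M\<close> the residue of \<open>x - y\<close> is \<open>(x + (M - y)) mod M\<close>, with no truncation.\<close>

definition convolution ::
    "nat \<Rightarrow> (nat \<Rightarrow> 'a::comm_semiring_0) \<Rightarrow> (nat \<Rightarrow> 'a) \<Rightarrow> nat \<Rightarrow> 'a" where
  "convolution M f g x = (\<Sum>y<M. f y * g ((x + (M - y)) mod M))"

definition step_class :: "nat \<Rightarrow> nat \<Rightarrow> nat set" where
  "step_class M m = {z. z < M \<and> gcd z M = m}"

definition step_function :: "nat \<Rightarrow> (nat \<Rightarrow> 'a) \<Rightarrow> bool" where
  "step_function M f \<longleftrightarrow> (\<forall>m. m dvd M \<longrightarrow> f constant_on step_class M m)"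

definition eta :: "nat \<Rightarrow> complex" where
  "eta M = exp (- 2 * of_real pi * \<i> / of_nat M)"

text \<open>The \<open>n\<close>-th cyclotomic polynomial (for \<open>n > 0\<close>), with complex coefficients.\<close>

definition cyclotomic :: "nat \<Rightarrow> complex poly" where
  "cyclotomic n =
     (\<Prod>k\<in>totatives n. [:- exp (2 * of_real pi * \<i> * of_nat k / of_nat n), 1:])"

text \<open>
  The relation $\Phi_m(X) \mid F(X)$, for \<open>m dvd M\<close>: the numbers \<open>eta M ^ \<xi>\<close> with
  \<open>\<xi>\<close> in \<open>step_class M (M div m)\<close> are the primitive \<open>m\<close>-th roots of unity.
\<close>

definition cyclotomic_divides :: "nat \<Rightarrow> nat \<Rightarrow> complex poly \<Rightarrow> bool" where
  "cyclotomic_divides M m F \<longleftrightarrow> (\<forall>\<xi>\<in>step_class M (M div m). poly F (eta M ^ \<xi>) = 0)"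

definition prime_power_divisors :: "nat \<Rightarrow> complex poly \<Rightarrow> nat set" where
  "prime_power_divisors M F = {s. primepow s \<and> s dvd M \<and> cyclotomic_divides M s F}"

definition T1 :: "nat \<Rightarrow> complex poly \<Rightarrow> bool" where
  "T1 M F \<longleftrightarrow> poly F 1 = (\<Prod>s\<in>prime_power_divisors M F. poly (cyclotomic s) 1)"

text \<open>
  Powers of distinct primes are in particular distinct, so they are given as a set \<open>S\<close>. It has
  to be nonempty: the empty product would demand $\Phi_1(X) \mid F(X)$, that is, $F(1) = 0$.
\<close>

definition T2 :: "nat \<Rightarrow> complex poly \<Rightarrow> bool" where
  "T2 M F \<longleftrightarrow>
     (\<forall>S. S \<subseteq> prime_power_divisors M F \<and> S \<noteq> {} \<and> inj_on aprimedivisor S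
        \<longrightarrow> cyclotomic_divides M (\<Prod>S) F)"

end

theory Submission
  imports Defs
begin

text \<open>
  Every step function is a combination of the indicators of the subgroups $p^k q^l \mathbb{Z}_M$,
  and the Fourier transform maps the indicator of a subgroup to a multiple of that of its
  annihilator. Hence $f$ and $\hat f$ are both given by tables of partial sums of coefficients,
  and all conditions become conditions on the entries of $5 \times 3$ tables.
  The functions are chosen so that the supports of $\hat f$ and $\hat g$ meet only in $0$, which
  gives $f \ast g = 1$, with $S_F = \{p, p^4, q\}$ and $S_G = \{p^2, p^3, q^2\}$; this gives (T1)
  because $F(1) = G(1) = p^2 q$. Yet $\hat f$ does not vanish at frequencies of order $pq$, nor
  $\hat g$ at those of order $p^3 q^2$, so (T2) fails. The inequality $q < p^2$ makes the entries
  $1/q - 1/p^2$ of $f$ and $p^2 - q$ of $\hat f$ positive, and $p < q$ does the same for $q - p$.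
\<close>

section \<open>Cyclotomic polynomials of prime power order\<close>

lemma poly_cyclotomic_eq_0:
  assumes "k \<in> totatives n"
  shows "poly (cyclotomic n) (exp (2 * of_real pi * \<i> * of_nat k / of_nat n)) = 0"
proof -
  have "finite (totatives n)" by simp
  then show ?thesis
    unfolding cyclotomic_def poly_prod using assms by (intro prod_zero) auto
qed

lemma degree_cyclotomic: "degree (cyclotomic n) = totient n"
  unfolding cyclotomic_def totient_def by (subst degree_prod_sum_eq) auto

lemma lead_coeff_cyclotomic: "lead_coeff (cyclotomic n) = 1"
  unfolding cyclotomic_def by (simp add: lead_coeff_prod)

text \<open>Both sides are monic of degree \<open>(p - 1) * p ^ n\<close> and vanish at the equally
  many primitive roots of unity of order \<open>p ^ Suc n\<close>, so they coincide.\<close>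

lemma cyclotomic_prime_power:
  assumes p: "prime p"
  shows "cyclotomic (p ^ Suc n) = (\<Sum>i<p. monom 1 (i * p ^ n))" (is "_ = ?Q")
proof -
  let ?N = "p ^ Suc n" and ?P = "p ^ n"
  define z where "z k = exp (2 * of_real pi * \<i> * of_nat k / of_nat ?N)" for k
  have N: "1 \<le> ?N" and p1: "p > 1" and P: "?P > 0"
    using prime_gt_1_nat[OF p] by (auto simp: Suc_le_eq)
  have tot: "totient ?N = (p - 1) * ?P"
    using totient_prime_power_Suc[OF p, of n] by (simp add: mult.commute)
  have zpow: "z k ^ m = z (k * m)" for k m
    unfolding z_def exp_of_nat_mult [symmetric] by (simp add: algebra_simps)
  have root: "poly ?Q (z k) = 0" if k: "k \<in> totatives ?N" for k
  proof -
    have "coprime k p" using k by (simp add: in_totatives_iff)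
    then have "\<not> p dvd k" using p by (metis coprime_absorb_right not_prime_unit)
    then have "\<not> ?N dvd k * ?P" using P by simp
    \<comment> \<open>The \<open>?P\<close>-th power of \<open>z k\<close> is a \<open>p\<close>-th
      root of unity other than 1, so its geometric sum vanishes.\<close>
    then have "z (k * ?P) \<noteq> 1"
      unfolding z_def using complex_root_unity_eq_1[OF N] by blast
    moreover have "z (k * ?P * p) = 1"
      unfolding z_def using complex_root_unity_eq_1[OF N, of "k * ?P * p"]
      by (simp add: mult_ac)
    ultimately have "z (k * ?P) \<noteq> 1" "z (k * ?P) ^ p = 1"
      unfolding zpow by simp_all
    then have "(\<Sum>i<p. z (k * ?P) ^ i) = 0"
      by (simp add: sum_gp_strict)
    then show ?thesis by (simp add: poly_sum poly_monom zpow mult_ac)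
  qed
  have deg: "degree ?Q \<le> (p - 1) * ?P"
    by (intro degree_sum_le) (auto intro!: order.trans[OF degree_monom_le] mult_right_mono)
  have lc: "coeff ?Q ((p - 1) * ?P) = 1"
  proof -
    have "coeff ?Q ((p - 1) * ?P) = (\<Sum>i<p. if i = p - 1 then 1 else 0)"
      unfolding coeff_sum using P by (intro sum.cong) auto
    also have "\<dots> = 1" using p1 by simp
    finally show ?thesis .
  qed
  have inj: "inj_on z (totatives ?N)"
  proof
    fix x y assume xy: "x \<in> totatives ?N" "y \<in> totatives ?N" "z x = z y"
    then have "x mod ?N = y mod ?N"
      unfolding z_def using complex_root_unity_eq[OF N] by blast
    \<comment> \<open>\<open>totatives\<close> ranges up to and including \<open>?N\<close>;
      coprimality rules out \<open>?N\<close> itself once \<open>?N > 1\<close>.\<close>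
    moreover have "?N > 1" using p1 by (rule one_less_power) simp
    then have "x < ?N" "y < ?N"
      using xy(1,2) by (auto simp: in_totatives_iff le_less simp del: power_Suc)
    ultimately show "x = y" by simp
  qed
  show ?thesis
  proof (rule poly_eqI_degree_lead_coeff[where n = "(p - 1) * ?P" and A = "z ` totatives ?N"])
    show "coeff (cyclotomic ?N) ((p - 1) * ?P) = coeff ?Q ((p - 1) * ?P)"
      using lead_coeff_cyclotomic[of ?N] lc by (simp add: degree_cyclotomic tot del: power_Suc)
    show "(p - 1) * ?P \<le> card (z ` totatives ?N)"
      using inj tot by (simp add: card_image totient_def del: power_Suc)
    show "degree (cyclotomic ?N) \<le> (p - 1) * ?P"
      using degree_cyclotomic tot by simp
    show "poly (cyclotomic ?N) w = poly ?Q w" if "w \<in> z ` totatives ?N" for w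
      using that root poly_cyclotomic_eq_0[of _ ?N] by (auto simp: z_def simp del: power_Suc)
  qed (rule deg)
qed

lemma poly_cyclotomic_prime_power_1:
  assumes "prime p" "a > 0"
  shows "poly (cyclotomic (p ^ a)) 1 = of_nat p"
  using cyclotomic_prime_power[OF assms(1), of "a - 1"] assms(2)
  by (simp add: poly_sum poly_monom)

section \<open>The Fourier transform\<close>

lemma eta_power: "eta M ^ n = exp (- 2 * of_real pi * \<i> * of_nat n / of_nat M)"
  unfolding eta_def exp_of_nat_mult [symmetric] by (simp add: algebra_simps)

lemma eta_power_eq_1_iff:
  assumes "M > 0"
  shows "eta M ^ n = 1 \<longleftrightarrow> M dvd n"
proof -
  have "eta M ^ n = inverse (exp (2 * of_real pi * \<i> * of_nat n / of_nat M))"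
    unfolding eta_power exp_minus [symmetric] by simp
  then show ?thesis using complex_root_unity_eq_1[of M n] assms by (simp del: exp_eq_1)
qed

lemma eta_power_cong:
  assumes "M > 0" "m mod M = n mod M"
  shows "eta M ^ m = eta M ^ n"
proof -
  have "eta M ^ k = eta M ^ (k mod M)" for k
  proof -
    have "eta M ^ (M * (k div M) + k mod M) = eta M ^ (k mod M)"
      using eta_power_eq_1_iff[OF assms(1), of M] by (simp only: power_add power_mult) simp
    then show ?thesis by simp
  qed
  then show ?thesis using assms(2) by metis
qed

text \<open>A geometric sum whose ratio \<open>eta M ^ n\<close> is an \<open>M\<close>-th root of
  unity: the orthogonality relation for characters.\<close>

lemma sum_eta_power:
  assumes "M > 0"
  shows "(\<Sum>k<M. eta M ^ (k * n)) = (if M dvd n then of_nat M else 0)"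
proof -
  have "(\<Sum>k<M. eta M ^ (k * n)) = (\<Sum>k<M. (eta M ^ n) ^ k)"
    by (simp add: power_mult [symmetric] mult.commute)
  also have "\<dots> = (if M dvd n then of_nat M else 0)"
    using eta_power_eq_1_iff[OF assms, of n] eta_power_eq_1_iff[OF assms, of "n * M"]
    by (auto simp: sum_gp_strict power_mult)
  finally show ?thesis .
qed

section \<open>Transforms of subgroups and convolutions, inversion\<close>

lemma fourier_eq: "fourier M f \<xi> = (\<Sum>z<M. f z * eta M ^ (z * \<xi>))"
  unfolding fourier_def by (simp add: eta_power mult_ac)

text \<open>Turns divisibility by cyclotomic polynomials into vanishing of the Fourier
  transform.\<close>

lemma poly_mask_poly_eta: "poly (mask_poly M f) (eta M ^ \<xi>) = fourier M f \<xi>"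
  unfolding mask_poly_def fourier_eq
  by (simp add: poly_sum poly_monom power_mult [symmetric] mult.commute)

lemma fourier_sum: "fourier M (\<lambda>z. \<Sum>i\<in>I. f i z) \<xi> = (\<Sum>i\<in>I. fourier M (f i) \<xi>)"
  unfolding fourier_eq by (simp add: sum_distrib_right sum.swap[of _ I])

lemma fourier_cmult: "fourier M (\<lambda>z. c * f z) \<xi> = c * fourier M f \<xi>"
  unfolding fourier_eq by (simp add: sum_distrib_left mult.assoc)

text \<open>The multiples of \<open>d\<close> form the subgroup of order \<open>e\<close>. A
  character sums over it to \<open>e\<close> if it is trivial there, which means
  \<open>e dvd \<xi>\<close>, and to 0 otherwise.\<close>

lemma fourier_subgroup:
  assumes "d * e = M" "M > 0"
  shows "fourier M (\<lambda>z. of_bool (d dvd z)) \<xi> = of_nat e * of_bool (e dvd \<xi>)"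
proof -
  have d: "d > 0" and e: "e > 0" using assms by auto
  have "fourier M (\<lambda>z. of_bool (d dvd z)) \<xi> = (\<Sum>z | z < M \<and> d dvd z. eta M ^ (z * \<xi>))"
    unfolding fourier_eq by (rule sum.mono_neutral_cong_right) auto
  also have "\<dots> = (\<Sum>j<e. eta M ^ (d * j * \<xi>))"
    by (rule sum.reindex_bij_witness[where i = "\<lambda>j. d * j" and j = "\<lambda>z. z div d"])
       (use assms d in \<open>auto simp: less_mult_imp_div_less mult.commute\<close>)
  also have "\<dots> = (\<Sum>j<e. eta e ^ (j * \<xi>))"
  proof -
    have "eta M ^ d = eta e"
      unfolding eta_power unfolding eta_def using assms(1) d by (simp flip: assms(1))
    then show ?thesis by (simp add: power_mult mult.assoc)
  qed
  finally show ?thesis using sum_eta_power[OF e] by simp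
qed

lemma fourier_convolution:
  assumes "M > 0"
  shows "fourier M (convolution M f g) \<xi> = fourier M f \<xi> * fourier M g \<xi>"
proof -
  have *: "(\<Sum>x<M. g ((x + (M - y)) mod M) * eta M ^ (x * \<xi>))
         = eta M ^ (y * \<xi>) * fourier M g \<xi>" if y: "y < M" for y
  proof -
    \<comment> \<open>Here \<open>M - y\<close> stands for the negative of \<open>y\<close>, so the
      two shifts are inverse permutations of the residues.\<close>
    have inv: "((x + (M - y)) mod M + y) mod M = x mod M"
              "((x + y) mod M + (M - y)) mod M = x mod M" for x
    proof -
      have "x + (M - y) + y = x + M" "x + y + (M - y) = x + M" using y by auto
      then show "((x + (M - y)) mod M + y) mod M = x mod M"
                "((x + y) mod M + (M - y)) mod M = x mod M"
        by (simp_all only: mod_add_left_eq mod_add_self2)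
    qed
    have "(\<Sum>x<M. g ((x + (M - y)) mod M) * eta M ^ (x * \<xi>))
        = (\<Sum>x<M. g x * eta M ^ ((x + y) * \<xi>))"
    proof (rule sum.reindex_bij_witness[where i = "\<lambda>x. (x + y) mod M"
             and j = "\<lambda>x. (x + (M - y)) mod M"])
      fix x assume "x \<in> {..<M}"
      have "(((x + (M - y)) mod M + y) * \<xi>) mod M = (x * \<xi>) mod M"
        using inv(1)[of x] by (metis mod_mult_left_eq)
      then show "g ((x + (M - y)) mod M) * eta M ^ (((x + (M - y)) mod M + y) * \<xi>)
          = g ((x + (M - y)) mod M) * eta M ^ (x * \<xi>)"
        using eta_power_cong[OF assms] by metis
    qed (use inv assms in auto)
    also have "\<dots> = eta M ^ (y * \<xi>) * fourier M g \<xi>"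
      unfolding fourier_eq sum_distrib_left
      by (intro sum.cong refl) (simp add: distrib_right power_add)
    finally show ?thesis .
  qed
  have "fourier M (convolution M f g) \<xi>
      = (\<Sum>y<M. f y * (\<Sum>x<M. g ((x + (M - y)) mod M) * eta M ^ (x * \<xi>)))"
    unfolding fourier_eq convolution_def sum_distrib_left sum_distrib_right
    by (subst sum.swap) (simp add: mult.assoc)
  also have "\<dots> = (\<Sum>y<M. f y * (eta M ^ (y * \<xi>) * fourier M g \<xi>))"
    using * by (intro sum.cong) auto
  also have "\<dots> = fourier M f \<xi> * fourier M g \<xi>"
    by (simp add: fourier_eq[of M f] sum_distrib_right mult.assoc)
  finally show ?thesis .
qed

text \<open>With \<open>M - x\<close> in the role of \<open>-x\<close>, orthogonality keeps only the
  term with \<open>z = x\<close>.\<close>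

lemma fourier_inversion:
  assumes "x < M"
  shows "(\<Sum>\<xi><M. fourier M h \<xi> * eta M ^ (\<xi> * (M - x))) = of_nat M * h x"
proof -
  have iff: "M dvd z + (M - x) \<longleftrightarrow> z = x" if "z < M" for z
  proof
    assume "M dvd z + (M - x)"
    then obtain k where k: "z + (M - x) = M * k" by (auto elim: dvdE)
    \<comment> \<open>The number \<open>z + (M - x)\<close> lies strictly between 0 and
      \<open>2 * M\<close>, so the only multiple of \<open>M\<close> it can be is
      \<open>M\<close>.\<close>
    have "0 < M * k" "M * k < M * 2" using k that assms by linarith+
    then have "k = 1" by simp
    then show "z = x" using k assms by simp
  qed (use assms in simp)
  have "(\<Sum>\<xi><M. fourier M h \<xi> * eta M ^ (\<xi> * (M - x)))
      = (\<Sum>z<M. h z * (\<Sum>\<xi><M. eta M ^ (\<xi> * (z + (M - x)))))"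
    unfolding fourier_eq sum_distrib_left sum_distrib_right
    by (subst sum.swap) (simp add: algebra_simps power_add)
  also have "\<dots> = (\<Sum>z<M. if z = x then of_nat M * h z else 0)"
    using assms iff by (intro sum.cong refl, subst sum_eta_power) auto
  also have "\<dots> = of_nat M * h x" using assms by simp
  finally show ?thesis .
qed

text \<open>By inversion only the frequency 0 contributes. This is how the convolution identity is
  obtained.\<close>

lemma eq_1_if_fourier:
  assumes "\<And>\<xi>. \<xi> < M \<Longrightarrow> fourier M h \<xi> = (if \<xi> = 0 then of_nat M else 0)" "x < M"
  shows "h x = 1"
proof -
  have "of_nat M * h x = (\<Sum>\<xi><M. if \<xi> = 0 then of_nat M else 0)"
    unfolding fourier_inversion[OF assms(2), symmetric] using assms(1)
    by (intro sum.cong) auto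
  also have "\<dots> = of_nat M" using assms(2) by simp
  finally show ?thesis using assms(2) by simp
qed


section \<open>Functions on subgroup chains\<close>

definition subgroup_sum :: "nat \<Rightarrow> nat \<Rightarrow> nat \<Rightarrow> nat \<Rightarrow> (nat \<Rightarrow> nat \<Rightarrow> real) \<Rightarrow> nat \<Rightarrow> real" where
  "subgroup_sum p q A B c z = (\<Sum>k\<le>A. \<Sum>l\<le>B. c k l * of_bool (p ^ k * q ^ l dvd z))"

text \<open>The value of \<open>subgroup_sum\<close> where the gcd with the modulus is
  \<open>p ^ i * q ^ j\<close>: exactly the subgroups with \<open>k \<le> i\<close> and
  \<open>l \<le> j\<close> contain such a point.\<close>

definition cumulative :: "(nat \<Rightarrow> nat \<Rightarrow> real) \<Rightarrow> nat \<Rightarrow> nat \<Rightarrow> real" where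
  "cumulative c i j = (\<Sum>k\<le>i. \<Sum>l\<le>j. c k l)"

text \<open>The coefficients of the Fourier transform: the subgroup with indices
  \<open>A - k\<close>, \<open>B - l\<close> has order \<open>p ^ k * q ^ l\<close>, and its
  annihilator has indices \<open>k\<close>, \<open>l\<close>.\<close>

definition dual_coeffs ::
    "nat \<Rightarrow> nat \<Rightarrow> nat \<Rightarrow> nat \<Rightarrow> (nat \<Rightarrow> nat \<Rightarrow> real) \<Rightarrow> nat \<Rightarrow> nat \<Rightarrow> real" where
  "dual_coeffs p q A B c k l = c (A - k) (B - l) * real (p ^ k * q ^ l)"

section \<open>Step functions for a modulus with two prime factors\<close>

locale two_primes =
  fixes p q A B M :: nat
  assumes p: "prime p" and q: "prime q" and neq: "p \<noteq> q" and M: "M = p ^ A * q ^ B"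
begin

lemma M_pos: "M > 0"
  unfolding M using p q by (simp add: prime_gt_0_nat)

lemma dvd_iff: "p ^ k * q ^ l dvd p ^ i * q ^ j \<longleftrightarrow> k \<le> i \<and> l \<le> j"
proof
  have cop: "coprime (p ^ m) (q ^ n)" for m n
    using p q neq by (simp add: primes_coprime)
  assume *: "p ^ k * q ^ l dvd p ^ i * q ^ j"
  have "p ^ k dvd p ^ i * q ^ j" using * by (rule dvd_mult_left)
  then have "p ^ k dvd p ^ i" using cop[of k j] by (simp add: coprime_dvd_mult_left_iff)
  moreover have "q ^ l dvd p ^ i * q ^ j" using * by (rule dvd_mult_right)
  then have "q ^ l dvd q ^ j"
    using cop[of i l] by (simp add: coprime_dvd_mult_right_iff coprime_commute)
  ultimately show "k \<le> i \<and> l \<le> j"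
    using prime_gt_1_nat[OF p] prime_gt_1_nat[OF q] by (auto dest: power_dvd_imp_le)
qed (auto intro: mult_dvd_mono le_imp_power_dvd)

lemma dvd_M_cases:
  assumes "d dvd M"
  obtains i j where "i \<le> A" "j \<le> B" "d = p ^ i * q ^ j"
proof -
  obtain b c where "d = b * c" "b dvd p ^ A" "c dvd q ^ B"
    using division_decomp[of d "p ^ A" "q ^ B"] assms M by auto
  then show ?thesis using that p q by (auto simp: divides_primepow_nat)
qed

lemma M_div:
  assumes "a \<le> A" "b \<le> B"
  shows "M div (p ^ a * q ^ b) = p ^ (A - a) * q ^ (B - b)"
proof -
  have "M = (p ^ a * q ^ b) * (p ^ (A - a) * q ^ (B - b))"
  proof -
    have "M = p ^ (a + (A - a)) * q ^ (b + (B - b))" using assms by (simp add: M)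
    then show ?thesis by (simp only: power_add mult_ac)
  qed
  moreover have "p ^ a * q ^ b > 0" using p q by (simp add: prime_gt_0_nat)
  ultimately show ?thesis by simp
qed

lemma subgroup_sum_eq:
  assumes "gcd z M = p ^ i * q ^ j" "i \<le> A" "j \<le> B"
  shows "subgroup_sum p q A B c z = cumulative c i j"
proof -
  have "p ^ k * q ^ l dvd z \<longleftrightarrow> k \<le> i \<and> l \<le> j" if "k \<le> A" "l \<le> B" for k l
  proof -
    have "p ^ k * q ^ l dvd M" using that unfolding M dvd_iff by simp
    then have "p ^ k * q ^ l dvd z \<longleftrightarrow> p ^ k * q ^ l dvd gcd z M" by simp
    then show ?thesis using assms(1) by (simp add: dvd_iff)
  qed
  then have "subgroup_sum p q A B c z
      = (\<Sum>k\<le>A. \<Sum>l\<le>B. c k l * of_bool (k \<le> i \<and> l \<le> j))"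
    unfolding subgroup_sum_def by (intro sum.cong refl) simp
  also have "\<dots> = (\<Sum>k\<le>A. of_bool (k \<le> i) * (\<Sum>l\<le>B. of_bool (l \<le> j) * c k l))"
    unfolding sum_distrib_left by (intro sum.cong refl) (simp add: of_bool_conj)
  also have "\<dots> = (\<Sum>k\<le>A. of_bool (k \<le> i) * (\<Sum>l\<le>j. c k l))"
    using assms(3) by (intro sum.cong refl arg_cong2[where f = "(*)"] sum.mono_neutral_cong_right) auto
  also have "\<dots> = cumulative c i j"
    unfolding cumulative_def using assms(2) by (intro sum.mono_neutral_cong_right) auto
  finally show ?thesis .
qed

text \<open>Reduces claims about all residues to finitely many table entries; the entry depends on
  \<open>z\<close> only, not on \<open>c\<close>.\<close>

lemma subgroup_sum_cases:
  obtains i j where "i \<le> A" "j \<le> B" "\<And>c. subgroup_sum p q A B c z = cumulative c i j"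
proof -
  obtain i j where "i \<le> A" "j \<le> B" "gcd z M = p ^ i * q ^ j"
    using dvd_M_cases[of "gcd z M"] by auto
  then show ?thesis using that subgroup_sum_eq by blast
qed

lemma subgroup_sum_0: "subgroup_sum p q A B c 0 = cumulative c A B"
  by (rule subgroup_sum_eq) (auto simp: M)

lemma step_function_subgroup_sum: "step_function M (subgroup_sum p q A B c)"
  unfolding step_function_def
proof (intro allI impI)
  fix m assume "m dvd M"
  then obtain i j where ij: "i \<le> A" "j \<le> B" "m = p ^ i * q ^ j" by (rule dvd_M_cases)
  then show "subgroup_sum p q A B c constant_on step_class M m"
    unfolding constant_on_def step_class_def by (auto intro!: subgroup_sum_eq)
qed

lemma fourier_subgroup_sum:
  "fourier M (complex_of_real \<circ> subgroup_sum p q A B c) \<xi>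
   = of_real (subgroup_sum p q A B (dual_coeffs p q A B c) \<xi>)"
proof -
  have "fourier M (complex_of_real \<circ> subgroup_sum p q A B c) \<xi>
      = (\<Sum>k\<le>A. \<Sum>l\<le>B. of_real (c k l) * fourier M (\<lambda>z. of_bool (p ^ k * q ^ l dvd z)) \<xi>)"
  proof -
    have "complex_of_real \<circ> subgroup_sum p q A B c =
        (\<lambda>z. \<Sum>k\<le>A. \<Sum>l\<le>B. of_real (c k l) * of_bool (p ^ k * q ^ l dvd z))"
      unfolding subgroup_sum_def comp_def of_real_sum of_real_mult
      by (intro ext sum.cong refl) simp
    then show ?thesis by (simp only: fourier_sum fourier_cmult)
  qed
  also have "\<dots> = (\<Sum>k\<le>A. \<Sum>l\<le>B. of_real (c k l) *
      (of_nat (p ^ (A - k) * q ^ (B - l)) * of_bool (p ^ (A - k) * q ^ (B - l) dvd \<xi>)))"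
  proof (intro sum.cong refl arg_cong2[where f = "(*)"] fourier_subgroup M_pos)
    fix k l assume "k \<in> {..A}" "l \<in> {..B}"
    then show "p ^ k * q ^ l * (p ^ (A - k) * q ^ (B - l)) = M"
      using M_div[of k l] M_pos dvd_iff[of k l A B] by (metis M atMost_iff dvd_mult_div_cancel)
  qed
  \<comment> \<open>Reversing both indices lists the annihilators in the order of the original
    chain.\<close>
  also have "\<dots> = (\<Sum>k\<le>A. \<Sum>l\<le>B. of_real (c (A - k) (B - l)) *
      (of_nat (p ^ k * q ^ l) * of_bool (p ^ k * q ^ l dvd \<xi>)))"
    by (rule sum.reindex_bij_witness[where i = "\<lambda>k. A - k" and j = "\<lambda>k. A - k"], simp_all)
       (rule sum.reindex_bij_witness[where i = "\<lambda>l. B - l" and j = "\<lambda>l. B - l"], simp_all)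
  also have "\<dots> = of_real (subgroup_sum p q A B (dual_coeffs p q A B c) \<xi>)"
    unfolding subgroup_sum_def dual_coeffs_def of_real_sum of_real_mult
    by (intro sum.cong refl) simp
  finally show ?thesis .
qed

abbreviation mask where
  "mask c \<equiv> mask_poly M (complex_of_real \<circ> subgroup_sum p q A B c)"

abbreviation hat where
  "hat c \<equiv> cumulative (dual_coeffs p q A B c)"

section \<open>Cyclotomic divisibility, (T1) and (T2) read off the tables\<close>

text \<open>The transform is constant on the class of frequencies of order
  \<open>p ^ a * q ^ b\<close>, so vanishing there concerns a single entry.\<close>

lemma cyclotomic_divides_iff:
  assumes "a \<le> A" "b \<le> B" "a + b > 0"
  shows "cyclotomic_divides M (p ^ a * q ^ b) (mask c) \<longleftrightarrow> hat c (A - a) (B - b) = 0"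
proof -
  define m where "m = p ^ (A - a) * q ^ (B - b)"
  have "subgroup_sum p q A B (dual_coeffs p q A B c) \<xi> = hat c (A - a) (B - b)"
    if "\<xi> \<in> step_class M m" for \<xi>
    using that by (intro subgroup_sum_eq) (auto simp: step_class_def m_def)
  \<comment> \<open>The class must be nonempty for a zero to be read off; \<open>a + b > 0\<close>
    makes \<open>m < M\<close>, so that \<open>m\<close> represents it.\<close>
  moreover have "m \<in> step_class M m"
  proof -
    have "m dvd M" unfolding m_def M dvd_iff by simp
    moreover have "\<not> M dvd m" unfolding m_def M dvd_iff using assms by auto
    ultimately show ?thesis
      using M_pos by (auto simp: step_class_def intro!: le_neq_implies_less dvd_imp_le)
  qed
  ultimately show ?thesis
    unfolding cyclotomic_divides_def M_div[OF assms(1,2)] m_def [symmetric]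
    by (auto simp: poly_mask_poly_eta fourier_subgroup_sum)
qed

text \<open>Powers of \<open>p\<close> are decided by the last column of the table of the transform,
  powers of \<open>q\<close> by its last row.\<close>

lemma prime_power_divisors_mask:
  "prime_power_divisors M (mask c) =
     (\<lambda>a. p ^ a) ` {a \<in> {1..A}. hat c (A - a) B = 0} \<union>
     (\<lambda>b. q ^ b) ` {b \<in> {1..B}. hat c A (B - b) = 0}" (is "_ = ?S")
proof (rule Set.set_eqI)
  fix s
  have pa: "p ^ a dvd M \<longleftrightarrow> a \<le> A" for a using dvd_iff[of a 0 A B] by (simp add: M)
  have qb: "q ^ b dvd M \<longleftrightarrow> b \<le> B" for b using dvd_iff[of 0 b A B] by (simp add: M)
  have pc: "cyclotomic_divides M (p ^ a) (mask c) \<longleftrightarrow> hat c (A - a) B = 0"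
    if "0 < a" "a \<le> A" for a using cyclotomic_divides_iff[of a 0 c] that by simp
  have qc: "cyclotomic_divides M (q ^ b) (mask c) \<longleftrightarrow> hat c A (B - b) = 0"
    if "0 < b" "b \<le> B" for b using cyclotomic_divides_iff[of 0 b c] that by simp
  show "s \<in> prime_power_divisors M (mask c) \<longleftrightarrow> s \<in> ?S"
  proof
    assume s: "s \<in> prime_power_divisors M (mask c)"
    then obtain r e where re: "prime r" "e > 0" "s = r ^ e"
      by (auto simp: prime_power_divisors_def primepow_def)
    have "r dvd p ^ A * q ^ B"
      using s re M by (auto simp: prime_power_divisors_def intro: dvd_trans[OF dvd_power])
    then have "r = p \<or> r = q"
      using re(1) p q by (metis prime_dvd_mult_iff prime_dvd_power primes_dvd_imp_eq)
    then show "s \<in> ?S"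
      using s re pa qb pc qc by (auto simp: prime_power_divisors_def Suc_le_eq)
  next
    assume "s \<in> ?S"
    then show "s \<in> prime_power_divisors M (mask c)"
      using p q pa qb pc qc by (auto simp: prime_power_divisors_def Suc_le_eq)
  qed
qed

text \<open>Each power of \<open>p\<close> in the set contributes a factor \<open>p\<close> and each
  power of \<open>q\<close> a factor \<open>q\<close>, while the value of the mask polynomial at 1
  is the transform at frequency 0.\<close>

lemma T1_mask_iff:
  "T1 M (mask c) \<longleftrightarrow> hat c A B =
     real (p ^ card {a \<in> {1..A}. hat c (A - a) B = 0} *
           q ^ card {b \<in> {1..B}. hat c A (B - b) = 0})"
    (is "_ \<longleftrightarrow> _ = real (p ^ card ?I * q ^ card ?J)")
proof -
  have "p ^ a \<noteq> q ^ b" if "a > 0" for a b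
    using dvd_iff[of a 0 0 b] that by auto
  then have disj: "(\<lambda>a. p ^ a) ` ?I \<inter> (\<lambda>b. q ^ b) ` ?J = {}" by auto
  have inj: "inj_on (\<lambda>a. p ^ a) ?I" "inj_on (\<lambda>b. q ^ b) ?J"
    using prime_gt_1_nat[OF p] prime_gt_1_nat[OF q] by (auto intro!: inj_onI)
  have "(\<Prod>s\<in>prime_power_divisors M (mask c). poly (cyclotomic s) 1)
      = (\<Prod>a\<in>?I. poly (cyclotomic (p ^ a)) 1) * (\<Prod>b\<in>?J. poly (cyclotomic (q ^ b)) 1)"
    unfolding prime_power_divisors_mask
    by (subst prod.union_disjoint) (use disj inj in \<open>auto simp: prod.reindex\<close>)
  also have "\<dots> = of_nat p ^ card ?I * of_nat q ^ card ?J"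
    using p q by (simp add: poly_cyclotomic_prime_power_1)
  finally have prod: "(\<Prod>s\<in>prime_power_divisors M (mask c). poly (cyclotomic s) 1)
      = complex_of_real (real (p ^ card ?I * q ^ card ?J))" by simp
  have "poly (mask c) 1 = of_real (hat c A B)"
    using poly_mask_poly_eta[of M "complex_of_real \<circ> subgroup_sum p q A B c" 0]
    by (simp add: fourier_subgroup_sum subgroup_sum_0)
  then show ?thesis unfolding T1_def prod by (simp only: of_real_eq_iff)
qed

text \<open>The two-element set \<open>{p ^ a, q ^ b}\<close> is the counterexample.\<close>

lemma not_T2_mask:
  assumes "a \<in> {1..A}" "b \<in> {1..B}" "hat c (A - a) B = 0" "hat c A (B - b) = 0"
    and "hat c (A - a) (B - b) \<noteq> 0"
  shows "\<not> T2 M (mask c)"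
proof
  assume T2: "T2 M (mask c)"
  have "p ^ a \<noteq> q ^ b" using dvd_iff[of a 0 0 b] assms by auto
  then have prod: "\<Prod>{p ^ a, q ^ b} = p ^ a * q ^ b" by simp
  have "{p ^ a, q ^ b} \<subseteq> prime_power_divisors M (mask c)"
    unfolding prime_power_divisors_mask using assms by auto
  moreover have "inj_on aprimedivisor {p ^ a, q ^ b}"
    using assms p q neq by (auto simp: aprimedivisor_prime_power)
  ultimately have "cyclotomic_divides M (p ^ a * q ^ b) (mask c)"
    using T2 unfolding T2_def prod [symmetric] by blast
  then show False using assms by (subst (asm) cyclotomic_divides_iff) auto
qed

text \<open>The product of the transforms is \<open>M\<close> at frequency 0 and 0 elsewhere, which
  is the transform of the constant 1.\<close>

lemma convolution_subgroup_sum: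
  assumes "hat c A B * hat d A B = real M"
    and "\<And>i j. i \<le> A \<Longrightarrow> j \<le> B \<Longrightarrow> (i, j) \<noteq> (A, B) \<Longrightarrow> hat c i j = 0 \<or> hat d i j = 0"
    and "x < M"
  shows "convolution M (subgroup_sum p q A B c) (subgroup_sum p q A B d) x = 1"
proof -
  let ?f = "complex_of_real \<circ> subgroup_sum p q A B c"
  let ?g = "complex_of_real \<circ> subgroup_sum p q A B d"
  have "convolution M ?f ?g x = 1"
  proof (rule eq_1_if_fourier[OF _ assms(3)])
    fix \<xi> assume "\<xi> < M"
    obtain i j where ij: "i \<le> A" "j \<le> B" "gcd \<xi> M = p ^ i * q ^ j"
      using dvd_M_cases[of "gcd \<xi> M"] by auto
    have "fourier M (convolution M ?f ?g) \<xi> = of_real (hat c i j * hat d i j)"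
      using fourier_convolution[OF M_pos] fourier_subgroup_sum subgroup_sum_eq[OF ij(3,1,2)]
      by simp
    moreover have "hat c i j * hat d i j = (if \<xi> = 0 then real M else 0)"
    proof (cases "\<xi> = 0")
      case True
      then have "p ^ A * q ^ B dvd p ^ i * q ^ j" using ij(3) M by simp
      then have "i = A" "j = B" using ij dvd_iff by auto
      then show ?thesis using True assms(1) by simp
    next
      case False
      have "(i, j) \<noteq> (A, B)"
      proof
        assume "(i, j) = (A, B)"
        then have "M dvd \<xi>" using ij(3) M by (metis gcd_dvd1 prod.inject)
        then show False using \<open>\<xi> < M\<close> False by (auto dest: dvd_imp_le)
      qed
      then show ?thesis using assms(2)[OF ij(1,2)] False by auto
    qed
    ultimately show "fourier M (convolution M ?f ?g) \<xi> = (if \<xi> = 0 then of_nat M else 0)"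
      by simp
  qed
  moreover have "convolution M ?f ?g x
      = of_real (convolution M (subgroup_sum p q A B c) (subgroup_sum p q A B d) x)"
    by (simp add: convolution_def)
  ultimately show ?thesis by simp
qed

end


section \<open>The two functions\<close>

lemma sum_atMost_numerals:
  fixes h :: "nat \<Rightarrow> 'a::comm_monoid_add"
  shows "sum h {..0} = h 0" "sum h {..1} = h 0 + h 1" "sum h {..2} = h 0 + h 1 + h 2"
    "sum h {..3} = h 0 + h 1 + h 2 + h 3" "sum h {..4} = h 0 + h 1 + h 2 + h 3 + h 4"
  by (simp_all add: eval_nat_numeral)

lemma le_4_cases: "i \<le> 4 \<Longrightarrow> i = 0 \<or> i = 1 \<or> i = 2 \<or> i = 3 \<or> i = (4::nat)"
  and le_2_cases: "j \<le> 2 \<Longrightarrow> j = 0 \<or> j = 1 \<or> j = (2::nat)"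
  by arith+

text \<open>
  The coefficients are those of $(q - 1) f$ and $D g$, where $D$ is \<open>denom_g\<close>. They come from
  solving, for small $p$ and $q$, the linear program formed by the sign conditions, the two values
  at $0$ and the prescribed zeros of $\hat f$ and $\hat g$, and interpolating a vertex of it.
  Row \<open>i\<close>, column \<open>j\<close> of a table of cumulative sums is the value at $z$ with
  $\gcd(z, M) = p^i q^j$; for the transforms these are the frequencies of order $p^{4-i} q^{2-j}$.
\<close>

definition coeffs_f :: "nat \<Rightarrow> nat \<Rightarrow> nat \<Rightarrow> nat \<Rightarrow> real" where
  "coeffs_f p q k l =
     [[1 / real p ^ 2, - 1 / real p ^ 2, 0],
      [- 1 / real p ^ 2, 1 / q, (real q - p) / p],
      [0, 1 / real p ^ 2 - 1 / q, 0],
      [(real q - p) / q, real p / q, - real q / p],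
      [0, - 1, q]] ! k ! l"

lemma cumulative_coeffs_f:
  assumes "p > 0" "q > 0" "i \<le> 4" "j \<le> 2"
  shows "cumulative (coeffs_f p q) i j =
     [[1 / real p ^ 2, 0, 0],
      [0, 1 / q - 1 / real p ^ 2, 1 / q - 1 / real p ^ 2 + (real q - p) / p],
      [0, 0, (real q - p) / p],
      [(real q - p) / q, 1, 0],
      [(real q - p) / q, 0, real q - 1]] ! i ! j"
  using le_4_cases[OF assms(3)] le_2_cases[OF assms(4)] assms(1,2)
  by (elim disjE; simp add: cumulative_def coeffs_f_def sum_atMost_numerals;
      simp add: field_simps power2_eq_square)

text \<open>Every entry is \<open>p ^ 2 * q\<close>, the square root of
  \<open>p ^ 4 * q ^ 2\<close>, times the entry of \<open>cumulative_coeffs_f\<close> at the same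
  place: the function is its own transform up to this factor.\<close>

lemma hat_coeffs_f:
  assumes "p > 0" "q > 0" "i \<le> 4" "j \<le> 2"
  shows "cumulative (dual_coeffs p q 4 2 (coeffs_f p q)) i j =
     [[real q, 0, 0],
      [0, real p ^ 2 - q, real p ^ 2 - q + real p * q * (real q - p)],
      [0, 0, real p * q * (real q - p)],
      [real p ^ 2 * (real q - p), real p ^ 2 * q, 0],
      [real p ^ 2 * (real q - p), 0, real p ^ 2 * q * (real q - 1)]] ! i ! j"
  using le_4_cases[OF assms(3)] le_2_cases[OF assms(4)] assms(1,2)
  by (elim disjE; simp add: cumulative_def dual_coeffs_def coeffs_f_def sum_atMost_numerals;
      simp add: field_simps power2_eq_square power3_eq_cube power4_eq_xxxx)

definition coeffs_g :: "nat \<Rightarrow> nat \<Rightarrow> nat \<Rightarrow> nat \<Rightarrow> real" where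
  "coeffs_g p q k l =
     [[0, (real q - p) / p, 0],
      [1, - real q / p, 0],
      [- 1, real q + 1, - real q],
      [0, - real q, real p * q],
      [0, real p * (real q - p), 0]] ! k ! l"

text \<open>The value at 0 before normalisation. It equals \<open>(p - 1) * q + p * (q - p)\<close>,
  hence is positive for \<open>1 < p < q\<close>.\<close>

definition denom_g :: "nat \<Rightarrow> nat \<Rightarrow> real" where
  "denom_g p q = (2 * real p - 1) * q - real p ^ 2"

lemma cumulative_coeffs_g:
  assumes "p > 0" "q > 0" "i \<le> 4" "j \<le> 2"
  shows "cumulative (coeffs_g p q) i j =
     [[0, (real q - p) / p, (real q - p) / p],
      [1, 0, 0],
      [0, real q, 0],
      [0, 0, (real p - 1) * q],
      [0, real p * (real q - p), denom_g p q]] ! i ! j"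
  using le_4_cases[OF assms(3)] le_2_cases[OF assms(4)] assms(1,2)
  by (elim disjE; simp add: cumulative_def coeffs_g_def denom_g_def sum_atMost_numerals;
      simp add: field_simps power2_eq_square)

text \<open>Self-dual in the same sense, again with the factor \<open>p ^ 2 * q\<close>.\<close>

lemma hat_coeffs_g:
  assumes "p > 0" "q > 0" "i \<le> 4" "j \<le> 2"
  shows "cumulative (dual_coeffs p q 4 2 (coeffs_g p q)) i j =
     [[0, real p * q * (real q - p), real p * q * (real q - p)],
      [real p ^ 2 * q, 0, 0],
      [0, real p ^ 2 * real q ^ 2, 0],
      [0, 0, real p ^ 2 * real q ^ 2 * (real p - 1)],
      [0, real p ^ 3 * q * (real q - p), real p ^ 2 * q * denom_g p q]] ! i ! j"
  using le_4_cases[OF assms(3)] le_2_cases[OF assms(4)] assms(1,2)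
  by (elim disjE; simp add: cumulative_def dual_coeffs_def coeffs_g_def denom_g_def sum_atMost_numerals;
      simp add: field_simps power2_eq_square power3_eq_cube power4_eq_xxxx)

lemma cumulative_divide: "cumulative (\<lambda>k l. c k l / w) i j = cumulative c i j / w"
  by (simp add: cumulative_def sum_divide_distrib)

lemma dual_coeffs_divide:
  "dual_coeffs p q A B (\<lambda>k l. c k l / w) = (\<lambda>k l. dual_coeffs p q A B c k l / w)"
  by (simp add: dual_coeffs_def fun_eq_iff)

theorem theorem1p9:
  fixes p q M :: nat
  assumes "prime p" and "prime q" and "p < q" and "q < p ^ 2" and "M = p ^ 4 * q ^ 2"
  shows "\<exists>f g :: nat \<Rightarrow> real.
    f 0 = 1 \<and> g 0 = 1 \<and>
    (\<forall>z<M. f z \<ge> 0) \<and> (\<forall>z<M. g z \<ge> 0) \<and>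
    (\<forall>\<xi><M. fourier M (complex_of_real \<circ> f) \<xi> \<in> \<real>\<^sub>\<ge>\<^sub>0) \<and>
    (\<forall>\<xi><M. fourier M (complex_of_real \<circ> g) \<xi> \<in> \<real>\<^sub>\<ge>\<^sub>0) \<and>
    (\<forall>x<M. convolution M f g x = 1) \<and>
    step_function M f \<and> step_function M g \<and>
    T1 M (mask_poly M (complex_of_real \<circ> f)) \<and>
    T1 M (mask_poly M (complex_of_real \<circ> g)) \<and>
    \<not> T2 M (mask_poly M (complex_of_real \<circ> f)) \<and>
    \<not> T2 M (mask_poly M (complex_of_real \<circ> g))"
proof -
  interpret two_primes p q 4 2 M
    using assms by unfold_locales auto
  have p1: "real p > 1" and pq: "real p < real q"
    using prime_gt_1_nat[OF \<open>prime p\<close>] assms(3) by auto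
  have qp: "real q < real p ^ 2"
    using assms(4) by (simp flip: of_nat_power)
  have p0: "p > 0" and q0: "q > 0" using p1 pq by auto
  have rec: "1 / real q - 1 / real p ^ 2 > 0" using qp p0 q0 by (simp add: field_simps)
  define D where "D = denom_g p q"
  have D: "D > 0"
  proof -
    have "D = (real p - 1) * q + real p * (real q - p)"
      by (simp add: D_def denom_g_def algebra_simps power2_eq_square)
    also have "\<dots> > 0" using p1 pq by (intro add_pos_pos mult_pos_pos) auto
    finally show ?thesis .
  qed
  \<comment> \<open>The divisors are the corner entries of the two value tables, so both functions
    take the value 1 at 0.\<close>
  define c where "c k l = coeffs_f p q k l / (real q - 1)" for k l
  define d where "d k l = coeffs_g p q k l / D" for k l
  let ?f = "subgroup_sum p q 4 2 c" and ?g = "subgroup_sum p q 4 2 d"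
  have c: "cumulative c i j = cumulative (coeffs_f p q) i j / (real q - 1)"
    and hc: "hat c i j = hat (coeffs_f p q) i j / (real q - 1)"
    and d: "cumulative d i j = cumulative (coeffs_g p q) i j / D"
    and hd: "hat d i j = hat (coeffs_g p q) i j / D" for i j
    unfolding c_def d_def dual_coeffs_divide cumulative_divide by simp_all
  note c = c cumulative_coeffs_f[OF p0 q0]
    and hc = hc hat_coeffs_f[OF p0 q0]
    and d = d cumulative_coeffs_g[OF p0 q0]
    and hd = hd hat_coeffs_g[OF p0 q0, folded D_def]
  have sets: "{1..4} = {1, 2, 3, 4::nat}" "{1..2} = {1, 2::nat}" by auto
  have c_nonneg: "cumulative c i j \<ge> 0" and hc_nonneg: "hat c i j \<ge> 0"
    and d_nonneg: "cumulative d i j \<ge> 0" and hd_nonneg: "hat d i j \<ge> 0"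
    if "i \<le> 4" "j \<le> 2" for i j
    using le_4_cases[OF that(1)] le_2_cases[OF that(2)] p1 pq qp rec D
    by (elim disjE; simp add: c hc d hd D_def [symmetric])+
  have "?f 0 = 1" "?g 0 = 1"
    using p1 pq D by (simp_all add: subgroup_sum_0 c d D_def [symmetric])
  moreover have "?f z \<ge> 0" "?g z \<ge> 0" for z
    using subgroup_sum_cases[of z] c_nonneg d_nonneg by metis+
  moreover have "fourier M (complex_of_real \<circ> ?f) \<xi> \<in> \<real>\<^sub>\<ge>\<^sub>0"
    "fourier M (complex_of_real \<circ> ?g) \<xi> \<in> \<real>\<^sub>\<ge>\<^sub>0" for \<xi>
    unfolding fourier_subgroup_sum nonneg_Reals_of_real_iff
    using subgroup_sum_cases[of \<xi>] hc_nonneg hd_nonneg by metis+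
  moreover have "convolution M ?f ?g x = 1" if "x < M" for x
  proof (rule convolution_subgroup_sum[OF _ _ that])
    \<comment> \<open>Both corner entries equal \<open>p ^ 2 * q\<close>.\<close>
    show "hat c 4 2 * hat d 4 2 = real M"
      using p1 pq D by (simp add: hc hd M) (simp add: field_simps power2_eq_square power4_eq_xxxx)
    show "hat c i j = 0 \<or> hat d i j = 0" if "i \<le> 4" "j \<le> 2" "(i, j) \<noteq> (4, 2)" for i j
      using le_4_cases[OF that(1)] le_2_cases[OF that(2)] that(3)
      by (elim disjE; simp add: hc hd)
  qed
  moreover have "T1 M (mask c)"
  proof -
    \<comment> \<open>This entry belongs to frequencies of order \<open>p ^ 3\<close>; its
      positivity keeps \<open>p ^ 3\<close> out of the set for \<open>c\<close>.\<close>
    have "real p ^ 2 - q + real p * q * (real q - p) > 0"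
      using p1 pq qp by (intro add_pos_pos mult_pos_pos) auto
    then have "{a \<in> {1..4}. hat c (4 - a) 2 = 0} = {1, 4}"
      using p1 pq unfolding sets by (auto simp: hc)
    moreover have "{b \<in> {1..2}. hat c 4 (2 - b) = 0} = {1}"
      using p1 pq unfolding sets by (auto simp: hc)
    ultimately show ?thesis using p1 pq by (simp add: T1_mask_iff hc power2_eq_square)
  qed
  moreover have "T1 M (mask d)"
  proof -
    have "{a \<in> {1..4}. hat d (4 - a) 2 = 0} = {2, 3}"
      using p1 pq D unfolding sets by (auto simp: hd)
    moreover have "{b \<in> {1..2}. hat d 4 (2 - b) = 0} = {2}"
      using p1 pq D unfolding sets by (auto simp: hd)
    ultimately show ?thesis using p1 pq D by (simp add: T1_mask_iff hd power2_eq_square)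
  qed
  moreover have "\<not> T2 M (mask c)"
    \<comment> \<open>Order \<open>p * q\<close>: both prime factors divide, but the entry in row 3,
      column 1 is nonzero.\<close>
    by (rule not_T2_mask[of 1 1]) (use p1 pq in \<open>simp_all add: hc\<close>)
  moreover have "\<not> T2 M (mask d)"
    \<comment> \<open>Order \<open>p ^ 3 * q ^ 2\<close>, with the nonzero entry in row 1, column
      0.\<close>
    by (rule not_T2_mask[of 3 2]) (use p1 pq D in \<open>simp_all add: hd\<close>)
  ultimately show ?thesis
    using step_function_subgroup_sum by (intro exI[of _ ?f] exI[of _ ?g]) simp
qed

end
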